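(* Let $\Omega$ be a base space of locally integrable matrix functions as in the context. If for some $\omega\in\Omega$ the equation $\dot x=A(\omega_t)x$ has (uniform) $\mu$-dichotomy for some fast growth rate $\mu$ (equivalently, $0\notin\Sigma_{\mu\mathrm{D}}(\omega)$), then the orbit $\mathcal{O}(\omega)$ is homeomorphic to $\mathbb{R}$ and coincides with the hull $\mathbb{H}(\omega)$.
   Context: Skew-product setting. $\Omega$ is a space of locally integrable functions $\omega:\mathbb{R}\to\mathbb{R}^{N\times N}$, endowed with a topology such that the translation flow $\mathbb{R}\times\Omega\to\Omega$, $(\tau,\omega)\mapsto\omega_\tau$, $\omega_\tau(t)=\omega(t+\tau)$, is well defined and continuous; the evaluation map $A:\Omega\to\mathbb{R}^{N\times N}$, $A(\omega)=\omega(0)$, is continuous (so $A(\omega_t)=\omega(t)$); if $\widehat\omega=\lim_n\omega_{\tau_n}$ in $\Omega$ with $\tau_n\searrow-\infty$ or $\tau_n\nearrow+\infty$, then $\widehat\omega(t)=\lim_n\omega_{\tau_n}(t)$ for almost every $t$; and $(\omega,t,s)\mapsto\Phi_\omega(t,s)$ is jointly continuous, where $\Phi_\omega(t,s)$ denotes the evolution operator of $\dot x=A(\omega_t)x$. The orbit of $\omega$ is $\mathcal{O}(\omega)=\{\omega_\tau:\tau\in\mathbb{R}\}$ and the hull $\mathbb{H}(\omega)$ is the closure of $\mathcal{O}(\omega)$ in $\Omega$. Growth rates. A growth rate is a strictly increasing differentiable function $\mu:\mathbb{R}\to\mathbb{R}^+$ with $\mu(0)=1$, $\lim_{t\to+\infty}\mu(t)=+\infty$,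 $\lim_{t\to-\infty}\mu(t)=0$. For $r>1$ let $\mathrm{s}_r(t)=e^{\mathrm{sgn}(t)|t|^r}$. The growth rate $\mu$ is fast if there are $r\in(1,+\infty)$ and $M\ge1$ with $\frac{\mathrm{s}_r(t)}{\mathrm{s}_r(s)}\le M\frac{\mu(t)}{\mu(s)}$ for all $t\ge s$. Dichotomy. A linear equation $\dot x=B(t)x$ ($B$ locally integrable) with evolution operator $\Phi$ has (uniform) $\mu$-dichotomy if there are projections $\mathrm{P}(s)\in\mathbb{R}^{N\times N}$, $s\in\mathbb{R}$, with $\mathrm{P}(t)\Phi(t,s)=\Phi(t,s)\mathrm{P}(s)$ for all $t,s$, and constants $K\ge1$, $\alpha<0$, $\beta>0$ such that $\|\Phi(t,s)\mathrm{P}(s)\|\le K(\mu(t)/\mu(s))^\alpha$ for $t\ge s$ and $\|\Phi(t,s)[\mathrm{Id}-\mathrm{P}(s)]\|\le K(\mu(t)/\mu(s))^\beta$ for $t\le s$. For real $\gamma$, $\gamma\in\Sigma_{\mu\mathrm{D}}(\omega)$ means that the shifted equation $\dot y=\big(\omega(t)-\gamma\frac{\dot\mu(t)}{\mu(t)}\mathrm{Id}\big)y$ does not have $\mu$-dichotomy. *)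

theory Defs
  imports "HOL-Analysis.Analysis"
begin

subsection \<open>Linear equations and growth rates\<close>

definition locally_integrable :: "(real \<Rightarrow> 'a::euclidean_space) \<Rightarrow> bool" where
  "locally_integrable f \<longleftrightarrow> (\<forall>a b. f absolutely_integrable_on {a..b})"

text \<open>Equations with locally integrable coefficients are understood in the sense of Caratheodory:
  \<open>\<Phi>(t,s) = Id + \<integral>\<^sub>s\<^sup>t B(u) \<Phi>(u,s) du\<close> for all \<open>t\<close>, \<open>s\<close>, the oriented integral being split into
  the cases \<open>s \<le> t\<close> and \<open>t \<le> s\<close>. The integral equation makes \<open>\<Phi>(\<cdot>,s)\<close> continuous, so for locally
  integrable \<open>B\<close> the integrand is automatically Lebesgue integrable on compact intervals.\<close>

definition is_evolution_operator ::
    "(real \<Rightarrow> real^'n^'n) \<Rightarrow> (real \<Rightarrow> real \<Rightarrow> real^'n^'n) \<Rightarrow> bool" where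
  "is_evolution_operator B \<Phi> \<longleftrightarrow>
     (\<forall>t s. (s \<le> t \<longrightarrow> ((\<lambda>u. B u ** \<Phi> u s) has_integral (\<Phi> t s - mat 1)) {s..t}) \<and>
            (t \<le> s \<longrightarrow> ((\<lambda>u. B u ** \<Phi> u s) has_integral (mat 1 - \<Phi> t s)) {t..s}))"

text \<open>For locally integrable \<open>B\<close> there is exactly one such operator.\<close>

definition evolution_operator :: "(real \<Rightarrow> real^'n^'n) \<Rightarrow> real \<Rightarrow> real \<Rightarrow> real^'n^'n" where
  "evolution_operator B = (THE \<Phi>. is_evolution_operator B \<Phi>)"

definition growth_rate :: "(real \<Rightarrow> real) \<Rightarrow> bool" where
  "growth_rate \<mu> \<longleftrightarrow>
     (\<forall>t. \<mu> t > 0) \<and> strict_mono \<mu> \<and> (\<forall>t. \<mu> differentiable (at t)) \<and> \<mu> 0 = 1 \<and>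
     filterlim \<mu> at_top at_top \<and> (\<mu> \<longlongrightarrow> 0) at_bot"

definition s_rate :: "real \<Rightarrow> real \<Rightarrow> real" where
  "s_rate r t = exp (sgn t * \<bar>t\<bar> powr r)"

definition fast :: "(real \<Rightarrow> real) \<Rightarrow> bool" where
  "fast \<mu> \<longleftrightarrow>
     (\<exists>r>1. \<exists>M\<ge>1. \<forall>t s. s \<le> t \<longrightarrow> s_rate r t / s_rate r s \<le> M * (\<mu> t / \<mu> s))"

subsection \<open>Dichotomy and spectrum\<close>

text \<open>The matrix norm is the operator norm induced by the Euclidean norm; any other norm only
  changes the constant \<open>K\<close>.\<close>

definition mu_dichotomy :: "(real \<Rightarrow> real) \<Rightarrow> (real \<Rightarrow> real^'n^'n) \<Rightarrow> bool" where
  "mu_dichotomy \<mu> B \<longleftrightarrow>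
     (let \<Phi> = evolution_operator B in
      \<exists>(P :: real \<Rightarrow> real^'n^'n) K \<alpha> \<beta>.
        (\<forall>s. P s ** P s = P s) \<and>
        (\<forall>t s. P t ** \<Phi> t s = \<Phi> t s ** P s) \<and>
        K \<ge> 1 \<and> \<alpha> < 0 \<and> \<beta> > 0 \<and>
        (\<forall>t s. s \<le> t \<longrightarrow>
           onorm (\<lambda>x. (\<Phi> t s ** P s) *v x) \<le> K * (\<mu> t / \<mu> s) powr \<alpha>) \<and>
        (\<forall>t s. t \<le> s \<longrightarrow>
           onorm (\<lambda>x. (\<Phi> t s ** (mat 1 - P s)) *v x) \<le> K * (\<mu> t / \<mu> s) powr \<beta>))"

definition mu_spectrum :: "(real \<Rightarrow> real) \<Rightarrow> (real \<Rightarrow> real^'n^'n) \<Rightarrow> real set" where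
  "mu_spectrum \<mu> \<omega> =
     {\<gamma>. \<not> mu_dichotomy \<mu> (\<lambda>t. \<omega> t - (\<gamma> * (deriv \<mu> t / \<mu> t)) *\<^sub>R mat 1)}"

subsection \<open>The base space\<close>

definition translate :: "real \<Rightarrow> (real \<Rightarrow> 'a) \<Rightarrow> real \<Rightarrow> 'a" where
  "translate \<tau> \<omega> = (\<lambda>t. \<omega> (t + \<tau>))"

definition eval0 :: "(real \<Rightarrow> 'a) \<Rightarrow> 'a" where
  "eval0 \<omega> = \<omega> 0"

text \<open>The space is a topology on an arbitrary set (its \<^const>\<open>topspace\<close>) of honest functions, not of
  classes modulo null sets, since evaluation at \<open>0\<close> has to make sense.\<close>

locale base_space =
  fixes \<Omega> :: "(real \<Rightarrow> real^'n^'n) topology"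
  assumes integrable: "\<And>\<omega>. \<omega> \<in> topspace \<Omega> \<Longrightarrow> locally_integrable \<omega>"
    and flow_continuous:
      "continuous_map (prod_topology euclideanreal \<Omega>) \<Omega> (\<lambda>(\<tau>, \<omega>). translate \<tau> \<omega>)"
    and eval_continuous: "continuous_map \<Omega> euclidean eval0"
    and limit_AE:
      "\<And>\<omega> \<omega>' \<tau>. \<lbrakk>\<omega> \<in> topspace \<Omega>;
          (decseq \<tau> \<and> filterlim \<tau> at_bot sequentially) \<or>
          (incseq \<tau> \<and> filterlim \<tau> at_top sequentially);
          limitin \<Omega> (\<lambda>n. translate (\<tau> n) \<omega>) \<omega>' sequentially\<rbrakk>
        \<Longrightarrow> AE t in lebesgue. (\<lambda>n. translate (\<tau> n) \<omega> t) \<longlonglongrightarrow> \<omega>' t"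
    and evolution_continuous:
      "continuous_map (prod_topology \<Omega> (prod_topology euclideanreal euclideanreal)) euclidean
         (\<lambda>(\<omega>, t, s). evolution_operator (\<lambda>u. eval0 (translate u \<omega>)) t s)"

definition orbit :: "(real \<Rightarrow> 'a) \<Rightarrow> (real \<Rightarrow> 'a) set" where
  "orbit \<omega> = range (\<lambda>\<tau>. translate \<tau> \<omega>)"

definition orbit_hull :: "(real \<Rightarrow> 'a) topology \<Rightarrow> (real \<Rightarrow> 'a) \<Rightarrow> (real \<Rightarrow> 'a) set" where
  "orbit_hull \<Omega> \<omega> = \<Omega> closure_of orbit \<omega>"

end

theory Submission
  imports Defs
begin

text \<open>Evaluation at every time is continuous on \<open>\<Omega>\<close>, so \<open>\<Omega>\<close> is Hausdorff and its elements are continuous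
  functions. A fast \<open>\<mu>\<close> satisfies \<open>\<mu>(\<tau> + 1) / \<mu>(\<tau>) \<rightarrow> \<infinity>\<close> as \<open>\<bar>\<tau>\<bar> \<rightarrow> \<infinity>\<close>. If \<open>\<Phi>(\<tau> + 1, \<tau>)\<close> and its
  inverse stayed bounded along times \<open>\<tau>\<close> tending to infinity, the dichotomy estimates would make both
  \<open>P\<close> and \<open>Id - P\<close> vanish. As the evolution operator is continuous on \<open>\<Omega>\<close>, every point of \<open>\<Omega>\<close> therefore has a
  neighbourhood that \<open>\<omega>\<^sub>\<tau>\<close> visits only for bounded \<open>\<tau>\<close>. This makes \<open>\<tau> \<mapsto> \<omega>\<^sub>\<tau>\<close> injective and closed.\<close>

subsection \<open>Linear differential equations with continuous coefficients\<close>

lemma continuous_antiderivative_vanishing_at_0: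
  fixes g :: "real \<Rightarrow> 'a::euclidean_space"
  assumes "continuous_on UNIV g"
  obtains F where "F 0 = 0" "\<And>t. (F has_vector_derivative g t) (at t)"
proof -
  have "\<exists>F. \<forall>x :: real. - \<infinity> < ereal x \<longrightarrow> ereal x < \<infinity> \<longrightarrow> (F has_vector_derivative g x) (at x)"
    using assms by (intro einterval_antiderivative) (auto simp: continuous_on_eq_continuous_at)
  then obtain F where F: "\<And>x. (F has_vector_derivative g x) (at x)"
    by auto
  show thesis
  proof
    show "((\<lambda>x. F x - F 0) has_vector_derivative g t) (at t)" for t
      using has_vector_derivative_diff[OF F has_vector_derivative_const] by simp
  qed simp
qed

text \<open>Integrating a bound of size |u|^n/n! produces the next term of the exponential series;
  this is the induction step of the Picard estimate. Negative times reduce to positive ones through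
  the reflection u -> -u.\<close>

lemma norm_le_power_antiderivative:
  fixes F :: "real \<Rightarrow> 'a::real_normed_vector"
  assumes F: "\<And>t. (F has_vector_derivative g t) (at t)" and F0: "F 0 = 0"
    and bnd: "\<And>u. \<bar>u\<bar> \<le> R \<Longrightarrow> norm (g u) \<le> C * \<bar>u\<bar> ^ n / fact n" and t: "\<bar>t\<bar> \<le> R"
  shows "norm (F t) \<le> C * \<bar>t\<bar> ^ Suc n / fact (Suc n)"
proof -
  have pos: "norm (H t) \<le> C * t ^ Suc n / fact (Suc n)"
    if H: "\<And>t. (H has_vector_derivative h t) (at t)" "H 0 = 0"
      and h: "\<And>u. \<bar>u\<bar> \<le> R \<Longrightarrow> norm (h u) \<le> C * \<bar>u\<bar> ^ n / fact n" and "0 < t" "t \<le> R"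
    for H h and t :: real
  proof -
    have "norm (H t - H 0) \<le> C * t ^ Suc n / fact (Suc n) - C * 0 ^ Suc n / fact (Suc n)"
    proof (rule differentiable_bound_general[where f' = h and \<phi>' = "\<lambda>u. C * u ^ n / fact n"])
      show "continuous_on {0..t} H"
        using H(1) has_vector_derivative_continuous continuous_at_imp_continuous_on by blast
      show "((\<lambda>u. C * u ^ Suc n / fact (Suc n)) has_vector_derivative C * x ^ n / fact n) (at x)" for x
      proof -
        have "((\<lambda>u. C * u ^ Suc n / fact (Suc n)) has_real_derivative
            C * (real (Suc n) * x ^ n) / fact (Suc n)) (at x)"
          by (rule derivative_eq_intros refl | simp)+
        also have "C * (real (Suc n) * x ^ n) / fact (Suc n) = C * x ^ n / fact n"
          by (simp add: fact_Suc del: of_nat_Suc)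
        finally show ?thesis
          by (simp add: has_real_derivative_iff_has_vector_derivative)
      qed
      show "norm (h x) \<le> C * x ^ n / fact n" if "0 < x" "x < t" for x
        using h[of x] that \<open>t \<le> R\<close> by simp
    qed (use that in \<open>auto intro!: continuous_intros\<close>)
    then show ?thesis using H(2) by simp
  qed
  consider "t = 0" | "t > 0" | "t < 0" by linarith
  then show ?thesis
  proof cases
    case 1
    then show ?thesis using F0 by simp
  next
    case 2
    then show ?thesis using pos[OF F F0 bnd, of t] t by simp
  next
    case 3
    have d: "((\<lambda>u. F (- u)) has_vector_derivative - g (- u)) (at u)" for u
      using vector_diff_chain_at[OF has_vector_derivative_minus[OF has_vector_derivative_id] F] by (simp add: o_def)
    have "norm (- g (- u)) \<le> C * \<bar>u\<bar> ^ n / fact n" if "\<bar>u\<bar> \<le> R" for u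
      using bnd[of "- u"] that by simp
    from pos[OF d _ this, of "- t"] show ?thesis
      using 3 F0 t by simp
  qed
qed

text \<open>The Picard iterates of a continuous linear equation are bounded on \<open>[-R, R]\<close> by the terms of an
  exponential series, so their sum may be differentiated term by term.\<close>

lemma linear_ode_solution_exists:
  fixes A :: "real \<Rightarrow> 'a::euclidean_space \<Rightarrow>\<^sub>L 'a"
  assumes A: "continuous_on UNIV A"
  obtains X where "X 0 = x0" "\<And>t. (X has_vector_derivative A t (X t)) (at t)"
proof -
  define G where "G g = (SOME F. F 0 = 0 \<and> (\<forall>t. (F has_vector_derivative g t) (at t)))"
    for g :: "real \<Rightarrow> 'a"
  have G: "G g 0 = 0" "\<And>t. (G g has_vector_derivative g t) (at t)" if g: "continuous_on UNIV g" for g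
  proof -
    obtain F where "F 0 = 0" "\<And>t. (F has_vector_derivative g t) (at t)"
      using continuous_antiderivative_vanishing_at_0[OF g] by blast
    then have "\<exists>F. F 0 = 0 \<and> (\<forall>t. (F has_vector_derivative g t) (at t))" by blast
    from someI_ex[OF this] show "G g 0 = 0" "\<And>t. (G g has_vector_derivative g t) (at t)"
      unfolding G_def by blast+
  qed
  \<comment> \<open>\<open>T n\<close> is the difference of consecutive Picard iterates, so the
    solution will be the sum of all \<open>T n\<close>.\<close>
  define T where "T = rec_nat (\<lambda>_. x0) (\<lambda>_ f. G (\<lambda>t. A t (f t)))"
  have T_0: "T 0 = (\<lambda>_. x0)" and T_Suc: "T (Suc n) = G (\<lambda>t. A t (T n t))" for n
    by (simp_all add: T_def)
  have cont: "continuous_on UNIV (T n)" for n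
  proof (induction n)
    case (Suc n)
    have "continuous_on UNIV (\<lambda>t. A t (T n t))"
      by (intro continuous_intros A Suc)
    then have "(T (Suc n) has_vector_derivative A t (T n t)) (at t)" for t
      unfolding T_Suc by (rule G)
    then have "isCont (T (Suc n)) t" for t
      by (rule has_vector_derivative_continuous)
    then show ?case
      by (simp add: continuous_at_imp_continuous_on)
  qed (simp add: T_0)
  have "continuous_on UNIV (\<lambda>t. A t (T n t))" for n
    by (intro continuous_intros A cont)
  note T = G[OF this, folded T_Suc]
  \<comment> \<open>\<open>d n\<close> is the derivative of \<open>T n\<close>. Its index is shifted
    by one, with \<open>d 0 = 0\<close> because \<open>T 0\<close> is constant, so that summing the
    \<open>d n\<close> gives A(t) applied to the sum of the \<open>T n\<close>.\<close>
  define d where "d n t = (case n of 0 \<Rightarrow> 0 | Suc m \<Rightarrow> A t (T m t))" for n t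
  have d: "(T n has_vector_derivative d n t) (at t)" for n t
    using T by (cases n) (auto simp: d_def T_0)
  have *: "(\<lambda>n. T n t) sums (\<Sum>n. T n t) \<and>
      ((\<lambda>t. \<Sum>n. T n t) has_vector_derivative A t (\<Sum>n. T n t)) (at t)" if "\<bar>t\<bar> < R" for t R
  proof -
    have "compact (A ` {- R..R})"
      by (intro compact_continuous_image continuous_on_subset[OF A]) auto
    then obtain m0 where m0: "\<And>u. u \<in> {- R..R} \<Longrightarrow> norm (A u) \<le> m0"
      by (meson bounded_iff compact_imp_bounded imageI)
    define m where "m = max m0 0"
    have m: "norm (A u) \<le> m" if "\<bar>u\<bar> \<le> R" for u
      using m0[of u] that unfolding m_def by force
    have "m \<ge> 0" by (simp add: m_def)
    have T_le: "norm (T n u) \<le> norm x0 * m ^ n * \<bar>u\<bar> ^ n / fact n" if "\<bar>u\<bar> \<le> R" for n u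
      using that
    proof (induction n arbitrary: u)
      case (Suc n)
      have "norm (T (Suc n) u) \<le> (norm x0 * m ^ Suc n) * \<bar>u\<bar> ^ Suc n / fact (Suc n)"
      proof (rule norm_le_power_antiderivative[where g = "\<lambda>t. A t (T n t)" and R = R])
        fix v assume v: "\<bar>v\<bar> \<le> R"
        have "norm (A v (T n v)) \<le> m * (norm x0 * m ^ n * \<bar>v\<bar> ^ n / fact n)"
          by (intro order_trans[OF norm_blinfun] mult_mono m Suc v \<open>m \<ge> 0\<close>) simp_all
        then show "norm (A v (T n v)) \<le> norm x0 * m ^ Suc n * \<bar>v\<bar> ^ n / fact n"
          by (simp add: mult_ac)
      qed (use T Suc.prems in auto)
      then show ?case .
    qed (simp add: T_0)
    have T_bd: "norm (T n u) \<le> norm x0 * (m * R) ^ n / fact n" if "\<bar>u\<bar> \<le> R" for n u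
    proof -
      have "norm x0 * m ^ n * \<bar>u\<bar> ^ n / fact n \<le> norm x0 * m ^ n * R ^ n / fact n"
        using that \<open>m \<ge> 0\<close> by (intro divide_right_mono mult_left_mono power_mono) auto
      then show ?thesis using T_le[OF that, of n] by (simp add: power_mult_distrib mult.assoc)
    qed
    \<comment> \<open>\<open>M\<close> carries the same shift as \<open>d\<close> and is a summable
      majorant of it on (-R, R). The Weierstrass test then gives the uniform convergence needed for
      termwise differentiation.\<close>
    define M where "M n = (case n of 0 \<Rightarrow> 0 | Suc k \<Rightarrow> m * (norm x0 * (m * R) ^ k / fact k))" for n
    have exp_sum: "summable (\<lambda>n. norm x0 * (m * R) ^ n / fact n)"
      using summable_mult[OF summable_exp[of "m * R"], of "norm x0"] by (simp add: field_simps)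
    have "summable M"
      using summable_mult[OF exp_sum, of m] by (subst summable_Suc_iff[symmetric]) (simp add: M_def)
    have d_le: "norm (d n u) \<le> M n" if "u \<in> {- R<..<R}" for n u
    proof (cases n)
      case (Suc k)
      have "norm (A u (T k u)) \<le> m * (norm x0 * (m * R) ^ k / fact k)"
        using that \<open>m \<ge> 0\<close>
        by (intro order_trans[OF norm_blinfun] mult_mono m T_bd) auto
      then show ?thesis by (simp add: Suc d_def M_def)
    qed (simp add: d_def M_def)
    have unif: "uniform_limit {- R<..<R} (\<lambda>n u. \<Sum>i<n. d i u) (\<lambda>u. \<Sum>i. d i u) sequentially"
      by (rule Weierstrass_m_test[OF d_le \<open>summable M\<close>])
    have summ: "summable (\<lambda>n. T n u)" if "\<bar>u\<bar> \<le> R" for u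
      by (rule summable_comparison_test[OF _ exp_sum]) (use T_bd that in auto)
    have "(\<lambda>n. d n u) sums A u (\<Sum>n. T n u)" if "\<bar>u\<bar> \<le> R" for u
    proof -
      have "(\<lambda>n. d (Suc n) u) sums A u (\<Sum>n. T n u)"
        unfolding d_def
        using bounded_linear.sums[OF blinfun.bounded_linear_right summable_sums[OF summ[OF that]]]
        by simp
      moreover have "d 0 u = 0" by (simp add: d_def)
      ultimately show ?thesis using sums_Suc_iff[of "\<lambda>n. d n u"] by auto
    qed
    then have d_sum: "(\<Sum>n. d n u) = A u (\<Sum>n. T n u)" if "\<bar>u\<bar> \<le> R" for u
      using that sums_unique by metis
    have "\<exists>g. \<forall>x\<in>{- R<..<R}. (\<lambda>n. T n x) sums (g x) \<and>
        (g has_derivative (\<lambda>h. h *\<^sub>R (\<Sum>n. d n x))) (at x within {- R<..<R})"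
    proof (rule has_derivative_series)
      show "(T n has_derivative (\<lambda>h. h *\<^sub>R d n x)) (at x within {- R<..<R})" for n x
        using has_vector_derivative_at_within[OF d] by (simp add: has_vector_derivative_def)
      show "\<forall>\<^sub>F n in sequentially. \<forall>x\<in>{- R<..<R}. \<forall>h.
          norm ((\<Sum>i<n. h *\<^sub>R d i x) - h *\<^sub>R (\<Sum>n. d n x)) \<le> e * norm h" if "0 < e" for e
        using uniform_limitD[OF unif that]
      proof eventually_elim
        case (elim n)
        show ?case
        proof (intro ballI allI)
          fix x h :: real assume "x \<in> {- R<..<R}"
          then have "norm ((\<Sum>i<n. d i x) - (\<Sum>n. d n x)) \<le> e"
            using elim by (force simp: dist_norm)
          then have "\<bar>h\<bar> * norm ((\<Sum>i<n. d i x) - (\<Sum>n. d n x)) \<le> \<bar>h\<bar> * e"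
            by (intro mult_left_mono) auto
          then show "norm ((\<Sum>i<n. h *\<^sub>R d i x) - h *\<^sub>R (\<Sum>n. d n x)) \<le> e * norm h"
            by (simp flip: scaleR_sum_right scaleR_right_diff_distrib add: mult.commute)
        qed
      qed
      show "t \<in> {- R<..<R}" using that by auto
      show "(\<lambda>n. T n t) sums (\<Sum>n. T n t)"
        using summ that by (intro summable_sums) auto
    qed auto
    then obtain g where g: "\<And>x. x \<in> {- R<..<R} \<Longrightarrow> (\<lambda>n. T n x) sums (g x) \<and>
        (g has_derivative (\<lambda>h. h *\<^sub>R (\<Sum>n. d n x))) (at x within {- R<..<R})" by blast
    have tR: "t \<in> {- R<..<R}" using that by auto
    have "(g has_vector_derivative A t (\<Sum>n. T n t)) (at t)"
      using g[OF tR] at_within_open[OF tR] d_sum[of t] that by (simp add: has_vector_derivative_def)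
    moreover have "g x = (\<Sum>n. T n x)" if "x \<in> {- R<..<R}" for x
      using g[OF that] sums_unique by blast
    ultimately have "((\<lambda>t. \<Sum>n. T n t) has_vector_derivative A t (\<Sum>n. T n t)) (at t)"
      using has_vector_derivative_transform_within_open[of g _ t "{- R<..<R}"] tR by auto
    then show ?thesis using summ[of t] that by (auto intro: summable_sums)
  qed
  show thesis
  proof
    show "((\<lambda>t. \<Sum>n. T n t) has_vector_derivative A t (\<Sum>n. T n t)) (at t)" for t
      using *[of t "\<bar>t\<bar> + 1"] by simp
    have "T (Suc n) 0 = 0" for n using T by blast
    then have "T n 0 = (if n = 0 then x0 else 0)" for n
      by (cases n) (auto simp: T_0)
    then have "(\<lambda>n. T n 0) = (\<lambda>n. if n = 0 then x0 else 0)" by auto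
    then show "(\<Sum>n. T n 0) = x0"
      using sums_single[of 0 "\<lambda>_. x0"] sums_unique by fastforce
  qed
qed

section \<open>Matrix equations: integral form, fundamental matrices and the evolution
  operator\<close>

lemma bounded_bilinear_matrix_matrix_mult:
  "bounded_bilinear ((**) :: real^'m^'n \<Rightarrow> real^'k^'m \<Rightarrow> real^'k^'n)"
  by (simp add: bilinear_def linear_iff matrix_matrix_mult_def vec_eq_iff sum.distrib
      algebra_simps sum_distrib_left flip: bilinear_conv_bounded_bilinear)

lemma bounded_bilinear_matrix_vector_mult:
  "bounded_bilinear ((*v) :: real^'m^'n \<Rightarrow> real^'m \<Rightarrow> real^'n)"
  by (simp add: bilinear_def linear_iff algebra_simps scaleR_matrix_vector_assoc
      flip: bilinear_conv_bounded_bilinear)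

text \<open>A bootstrap: F is an indefinite integral and hence continuous, \<open>cont\<close> turns
  this into continuity of f, and the fundamental theorem of calculus then differentiates F at every
  point. In the application f is B times F.\<close>

lemma has_vector_derivative_if_integral:
  fixes F f :: "real \<Rightarrow> 'a::banach"
  assumes right: "\<And>t. s \<le> t \<Longrightarrow> (f has_integral (F t - F s)) {s..t}"
    and left: "\<And>t. t \<le> s \<Longrightarrow> (f has_integral (F s - F t)) {t..s}"
    and cont: "continuous_on UNIV F \<Longrightarrow> continuous_on UNIV f"
  shows "(F has_vector_derivative f t) (at t)"
proof -
  have integrable: "f integrable_on {a..b}" if "a \<le> s" "s \<le> b" for a b
    using has_integral_combine[OF that left right] that by blast
  have F_eq: "F a + integral {a..u} f = F u" if "a \<le> s" "a \<le> u" for a u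
  proof (cases "s \<le> u")
    case True
    have "(f has_integral (F s - F a + (F u - F s))) {a..u}"
      using has_integral_combine[OF \<open>a \<le> s\<close> True left[OF \<open>a \<le> s\<close>] right[OF True]] .
    then have "integral {a..u} f = F u - F a" by (simp add: integral_unique)
    then show ?thesis by simp
  next
    case False
    then have "integral {a..u} f + integral {u..s} f = integral {a..s} f"
      using Henstock_Kurzweil_Integration.integral_combine[of a u s f] integrable[of a s] that by simp
    moreover have "integral {u..s} f = F s - F u" "integral {a..s} f = F s - F a"
      using left[of u] left[of a] False that by (simp_all add: integral_unique)
    ultimately show ?thesis by (simp add: algebra_simps)
  qed
  \<comment> \<open>The interval [a u, b u] contains the base time s and has u in its interior, so
    the one-sided hypotheses glue together on it and the derivative within it is the two-sided
    one.\<close>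
  define a b where "a u = min s u - 1" and "b u = max s u + 1" for u
  have ab: "a u \<le> s" "s \<le> b u" "u \<in> {a u<..<b u}" for u by (auto simp: a_def b_def)
  have "isCont F u" for u
  proof -
    have "continuous_on {a u..b u} (\<lambda>v. F (a u) + integral {a u..v} f)"
      by (intro continuous_intros indefinite_integral_continuous_1 integrable ab)
    then have "continuous_on {a u..b u} F"
      by (rule continuous_on_eq) (simp add: F_eq ab)
    then show ?thesis
      using ab(3) by (simp add: continuous_on_interior)
  qed
  then have "continuous_on UNIV f"
    by (intro cont) (simp add: continuous_at_imp_continuous_on)
  then have "continuous_on {a t..b t} f"
    using continuous_on_subset by blast
  moreover have "t \<in> {a t..b t}"
    using ab(3)[of t] by simp
  ultimately have "((\<lambda>v. integral {a t..v} f) has_vector_derivative f t) (at t within {a t..b t})"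
    by (rule integral_has_vector_derivative)
  from has_vector_derivative_add[OF has_vector_derivative_const this]
  have "((\<lambda>v. F (a t) + integral {a t..v} f) has_vector_derivative f t) (at t within {a t..b t})"
    by simp
  moreover have "at t within {a t..b t} = at t"
    using ab(3)[of t] by (intro at_within_interior) simp
  ultimately have "((\<lambda>v. F (a t) + integral {a t..v} f) has_vector_derivative f t) (at t)"
    by simp
  moreover have "F (a t) + integral {a t..v} f = F v" if "v \<in> {a t<..<b t}" for v
    using F_eq[OF ab(1)] that by simp
  ultimately show ?thesis
    using has_vector_derivative_transform_within_open[OF _ open_greaterThanLessThan ab(3)] by blast
qed

text \<open>Forwards, the integral over a single point gives the initial value and the bootstrap
  above gives the derivative; backwards, the fundamental theorem of calculus applies.\<close>

lemma is_evolution_operator_iff_derivative: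
  assumes B: "continuous_on UNIV B"
  shows "is_evolution_operator B \<Phi> \<longleftrightarrow>
    (\<forall>s. \<Phi> s s = mat 1 \<and> (\<forall>t. ((\<lambda>t. \<Phi> t s) has_vector_derivative B t ** \<Phi> t s) (at t)))"
proof (intro iffI allI conjI)
  fix s
  assume \<Phi>: "is_evolution_operator B \<Phi>"
  note \<Phi> = \<Phi>[unfolded is_evolution_operator_def, THEN spec, THEN spec]
  note right = \<Phi>[THEN conjunct1, THEN mp] and left = \<Phi>[THEN conjunct2, THEN mp]
  have "\<Phi> s s - mat 1 = 0"
    by (rule has_integral_unique[OF right[OF order_refl]]) (simp add: has_integral_refl)
  then show diag: "\<Phi> s s = mat 1"
    by simp
  fix t
  show "((\<lambda>t. \<Phi> t s) has_vector_derivative B t ** \<Phi> t s) (at t)"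
  proof (rule has_vector_derivative_if_integral[where s = s])
    show "continuous_on UNIV (\<lambda>t. B t ** \<Phi> t s)" if "continuous_on UNIV (\<lambda>t. \<Phi> t s)"
      using bounded_bilinear.continuous_on[OF bounded_bilinear_matrix_matrix_mult B that] .
  qed (use left[of _ s] right[of s] in \<open>simp_all add: diag\<close>)
next
  assume *: "\<forall>s. \<Phi> s s = mat 1 \<and>
    (\<forall>t. ((\<lambda>t. \<Phi> t s) has_vector_derivative B t ** \<Phi> t s) (at t))"
  show "is_evolution_operator B \<Phi>"
    unfolding is_evolution_operator_def
  proof (intro allI conjI impI)
    fix t s :: real
    have d: "((\<lambda>t. \<Phi> t s) has_vector_derivative B u ** \<Phi> u s) (at u within S)" for u S
      by (rule has_vector_derivative_at_within) (use * in simp)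
    show "((\<lambda>u. B u ** \<Phi> u s) has_integral (\<Phi> t s - mat 1)) {s..t}" if "s \<le> t"
      using fundamental_theorem_of_calculus[OF that d] *[rule_format, THEN conjunct1, of s] by simp
    show "((\<lambda>u. B u ** \<Phi> u s) has_integral (mat 1 - \<Phi> t s)) {t..s}" if "t \<le> s"
      using fundamental_theorem_of_calculus[OF that d] *[rule_format, THEN conjunct1, of s] by simp
  qed
qed

text \<open>Z is the inverse of the fundamental matrix X, carried along with its own adjoint
  equation. This permits writing \<Phi>(t,s) as X(t) Z(s) without ever differentiating a matrix
  inverse.\<close>

definition fundamental_pair ::
    "(real \<Rightarrow> real^'n^'n) \<Rightarrow> (real \<Rightarrow> real^'n^'n) \<Rightarrow> (real \<Rightarrow> real^'n^'n) \<Rightarrow> bool" where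
  "fundamental_pair B X Z \<longleftrightarrow>
     (\<forall>t. (X has_vector_derivative B t ** X t) (at t)) \<and>
     (\<forall>t. (Z has_vector_derivative - (Z t ** B t)) (at t)) \<and>
     (\<forall>t. X t ** Z t = mat 1 \<and> Z t ** X t = mat 1)"

text \<open>The two terms Z B X of the product rule cancel. This serves twice: to show that Z
  inverts X, and to show that the evolution operator is unique.\<close>

lemma adjoint_solution_mult_constant:
  fixes B X Z :: "real \<Rightarrow> real^'n^'n"
  assumes "\<And>t. (X has_vector_derivative B t ** X t) (at t)"
    and "\<And>t. (Z has_vector_derivative - (Z t ** B t)) (at t)"
  shows "Z t ** X t = Z s ** X s"
proof -
  have neg: "(- P) ** Q = - (P ** Q)" for P Q :: "real^'n^'n"
    using bounded_bilinear.minus_left[OF bounded_bilinear_matrix_matrix_mult] .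
  have "((\<lambda>t. Z t ** X t) has_vector_derivative 0) (at u)" for u
    using bounded_bilinear.has_vector_derivative[OF bounded_bilinear_matrix_matrix_mult
        assms(2)[of u] assms(1)[of u]]
    by (simp add: neg matrix_mul_assoc)
  then have "((\<lambda>t. Z t ** X t) has_derivative (\<lambda>h. 0)) (at u within UNIV)" for u
    by (simp add: has_vector_derivative_def)
  from has_derivative_zero_unique[OF convex_UNIV this UNIV_I UNIV_I] show ?thesis .
qed

text \<open>The bilinear map h lets one result cover both multiplication from the left, for X, and
  the flipped product with -B, for Z. Matrices are treated as vectors on which
  \<open>h (B t)\<close> acts as a bounded operator.\<close>

lemma matrix_ode_solution_exists:
  fixes B :: "real \<Rightarrow> real^'n^'n" and h :: "real^'n^'n \<Rightarrow> real^'n^'n \<Rightarrow> real^'n^'n"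
  assumes h: "bounded_bilinear h" and B: "continuous_on UNIV B"
  obtains X where "X 0 = mat 1" "\<And>t. (X has_vector_derivative h (B t) (X t)) (at t)"
proof -
  have lin: "bounded_linear (h (B t))" for t
    by (rule bounded_bilinear.bounded_linear_right[OF h])
  have "continuous_on UNIV (\<lambda>t. Blinfun (h (B t)))"
    by (rule continuous_on_blinfun_componentwise)
      (simp add: bounded_linear_Blinfun_apply[OF lin] bounded_bilinear.continuous_on[OF h B])
  then obtain X where "X 0 = mat 1" "\<And>t. (X has_vector_derivative Blinfun (h (B t)) (X t)) (at t)"
    using linear_ode_solution_exists by blast
  then show thesis
    using that by (simp add: bounded_linear_Blinfun_apply[OF lin])
qed

lemma fundamental_pair_exists:
  fixes B :: "real \<Rightarrow> real^'n^'n"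
  assumes B: "continuous_on UNIV B"
  obtains X Z where "fundamental_pair B X Z"
proof -
  obtain X where X: "X 0 = mat 1" "\<And>t. (X has_vector_derivative B t ** X t) (at t)"
    using matrix_ode_solution_exists[OF bounded_bilinear_matrix_matrix_mult B] by blast
  obtain Z where Z: "Z 0 = mat 1" "\<And>t. (Z has_vector_derivative Z t ** (- B t)) (at t)"
    using matrix_ode_solution_exists[OF bounded_bilinear.flip[OF bounded_bilinear_matrix_matrix_mult],
      of "\<lambda>t. - B t"] B continuous_on_minus by blast
  have "Z t ** (- B t) = - (Z t ** B t)" for t
    using bounded_bilinear.minus_right[OF bounded_bilinear_matrix_matrix_mult] .
  note Z = Z[unfolded this]
  \<comment> \<open>The product is constant and equals the identity at 0; for square matrices a left
    inverse is also a right inverse.\<close>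
  have "Z t ** X t = mat 1" for t
    using adjoint_solution_mult_constant[OF X(2) Z(2), of t 0] X(1) Z(1) by simp
  then show thesis
    using that X(2) Z(2) matrix_left_right_inverse unfolding fundamental_pair_def by blast
qed

text \<open>For uniqueness, Z(t) \<Phi>(t,s) is constant in t for any competitor \<Phi>, hence equal
  to Z(s); multiplying by X(t) recovers \<Phi>(t,s).\<close>

lemma evolution_operator_fundamental_pair:
  assumes B: "continuous_on UNIV B" and XZ: "fundamental_pair B X Z"
  shows "evolution_operator B = (\<lambda>t s. X t ** Z s)"
  unfolding evolution_operator_def
proof (rule the_equality)
  show "is_evolution_operator B (\<lambda>t s. X t ** Z s)"
    unfolding is_evolution_operator_iff_derivative[OF B]
  proof (intro allI conjI)
    fix s t
    show "X s ** Z s = mat 1" using XZ by (simp add: fundamental_pair_def)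
    have "bounded_linear (\<lambda>P. P ** Z s)"
      by (rule bounded_bilinear.bounded_linear_left[OF bounded_bilinear_matrix_matrix_mult])
    from bounded_linear.has_vector_derivative[OF this, of X "B t ** X t" "at t"]
    show "((\<lambda>t. X t ** Z s) has_vector_derivative B t ** (X t ** Z s)) (at t)"
      using XZ by (simp add: fundamental_pair_def matrix_mul_assoc)
  qed
next
  fix \<Phi> assume "is_evolution_operator B \<Phi>"
  then have \<Phi>: "\<Phi> s s = mat 1" "((\<lambda>t. \<Phi> t s) has_vector_derivative B t ** \<Phi> t s) (at t)" for s t
    by (simp_all add: is_evolution_operator_iff_derivative[OF B])
  have "\<Phi> t s = X t ** Z s" for t s
  proof -
    have "Z t ** \<Phi> t s = Z s ** \<Phi> s s"
      using XZ \<Phi>(2) unfolding fundamental_pair_def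
      by (intro adjoint_solution_mult_constant[where X = "\<lambda>t. \<Phi> t s" and B = B]) auto
    then have "X t ** Z t ** \<Phi> t s = X t ** Z s"
      by (simp add: \<Phi>(1) flip: matrix_mul_assoc)
    then show ?thesis using XZ by (simp add: fundamental_pair_def)
  qed
  then show "\<Phi> = (\<lambda>t s. X t ** Z s)" by blast
qed

lemma evolution_operator_inverse:
  assumes "continuous_on UNIV B"
  shows "evolution_operator B t s ** evolution_operator B s t = mat 1"
proof -
  obtain X Z where XZ: "fundamental_pair B X Z"
    using fundamental_pair_exists[OF assms] .
  have "X t ** Z s ** (X s ** Z t) = X t ** (Z s ** X s) ** Z t"
    by (simp add: matrix_mul_assoc)
  then show ?thesis
    using XZ by (simp add: evolution_operator_fundamental_pair[OF assms XZ] fundamental_pair_def)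
qed

text \<open>Translating both members of a fundamental pair gives one for the translated coefficient.
  In this way \<Phi>(1,0) of a translate reads off \<Phi>(\<tau>+1,\<tau>) of the original
  equation.\<close>

lemma evolution_operator_translate:
  assumes B: "continuous_on UNIV B"
  shows "evolution_operator (\<lambda>u. B (u + \<tau>)) t s = evolution_operator B (t + \<tau>) (s + \<tau>)"
proof -
  obtain X Z where XZ: "fundamental_pair B X Z"
    using fundamental_pair_exists[OF assms] .
  have shift: "((\<lambda>u. F (u + \<tau>)) has_vector_derivative F' (u + \<tau>)) (at u)"
    if "\<And>u. (F has_vector_derivative F' u) (at u)" for F F' :: "real \<Rightarrow> real^'n^'n" and u
    using vector_diff_chain_at[OF has_vector_derivative_add[OF has_vector_derivative_id
      has_vector_derivative_const[of \<tau>]] that, of u] by (simp add: o_def)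
  have pair: "fundamental_pair (\<lambda>u. B (u + \<tau>)) (\<lambda>u. X (u + \<tau>)) (\<lambda>u. Z (u + \<tau>))"
    using XZ shift[of X "\<lambda>u. B u ** X u"] shift[of Z "\<lambda>u. - (Z u ** B u)"]
    unfolding fundamental_pair_def by blast
  have cont: "continuous_on UNIV (\<lambda>u. B (u + \<tau>))"
    by (rule continuous_on_compose2[OF B]) (auto intro!: continuous_intros)
  show ?thesis
    unfolding evolution_operator_fundamental_pair[OF B XZ]
      evolution_operator_fundamental_pair[OF cont pair] ..
qed

subsection \<open>Dichotomies with fast growth rates\<close>

text \<open>The exponent grows by at least \<sigma>^(r-1) over [\<sigma>, \<sigma>+1], as
  (\<sigma>+1)^r is at least (\<sigma>+1) \<sigma>^(r-1), and exp x exceeds x. For negative \<tau>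
  the endpoint of smaller modulus has modulus |\<tau>|-1, which accounts for the base on the
  left.\<close>

lemma s_rate_ratio_lower_bound:
  assumes "1 < r" "1 \<le> \<bar>\<tau>\<bar>"
  shows "(\<bar>\<tau>\<bar> - 1) powr (r - 1) \<le> s_rate r (\<tau> + 1) / s_rate r \<tau>"
proof -
  have incr: "\<sigma> powr (r - 1) \<le> (\<sigma> + 1) powr r - \<sigma> powr r" if "0 \<le> \<sigma>" for \<sigma>
  proof -
    have split: "x powr r = x * x powr (r - 1)" if "0 \<le> x" for x
      using that powr_mult_base[of x "r - 1"] by simp
    have "(\<sigma> + 1) * \<sigma> powr (r - 1) \<le> (\<sigma> + 1) * (\<sigma> + 1) powr (r - 1)"
      using that \<open>1 < r\<close> by (intro mult_left_mono powr_mono2) auto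
    then show ?thesis
      using that by (simp add: split algebra_simps)
  qed
  have "(\<bar>\<tau>\<bar> - 1) powr (r - 1) \<le> sgn (\<tau> + 1) * \<bar>\<tau> + 1\<bar> powr r - sgn \<tau> * \<bar>\<tau>\<bar> powr r"
  \<comment> \<open>At \<tau> = -1 the sign of \<tau>+1 is 0, so this point is checked directly;
    otherwise \<tau> and \<tau>+1 lie strictly on the same side of 0.\<close>
  proof (cases "\<tau> = -1 \<or> 0 < \<tau>")
    case True
    show ?thesis
    proof (cases "\<tau> = -1")
      case False
      with True have "0 < \<tau>" by simp
      have "(\<bar>\<tau>\<bar> - 1) powr (r - 1) \<le> \<tau> powr (r - 1)"
        using assms \<open>0 < \<tau>\<close> by (intro powr_mono2) auto
      then show ?thesis using incr[of \<tau>] \<open>0 < \<tau>\<close> by (simp add: sgn_if)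
    qed (use assms in simp)
  next
    case False
    then show ?thesis using incr[of "- \<tau> - 1"] assms by (auto simp: sgn_if)
  qed
  also have "\<dots> \<le> s_rate r (\<tau> + 1) / s_rate r \<tau>"
    using exp_ge_add_one_self[of "sgn (\<tau> + 1) * \<bar>\<tau> + 1\<bar> powr r - sgn \<tau> * \<bar>\<tau>\<bar> powr r"]
    unfolding s_rate_def exp_diff[symmetric] by linarith
  finally show ?thesis .
qed

lemma fast_unit_step_ratio_unbounded:
  assumes "fast \<mu>"
  obtains T where "\<And>\<tau>. T < \<bar>\<tau>\<bar> \<Longrightarrow> c \<le> \<mu> (\<tau> + 1) / \<mu> \<tau>"
proof -
  from assms obtain r M where r: "r > 1" and M: "M \<ge> 1"
    and le: "\<And>t s. s \<le> t \<Longrightarrow> s_rate r t / s_rate r s \<le> M * (\<mu> t / \<mu> s)"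
    unfolding fast_def by blast
  \<comment> \<open>The threshold 1 + b^(1/(r-1)) is where (|\<tau>|-1)^(r-1) reaches b. Truncation
    at 0 makes taking the root and raising it back to the power recover b also for negative
    c.\<close>
  define b where "b = max (M * c) 0"
  show thesis
  proof
    fix \<tau> :: real
    assume \<tau>: "1 + b powr (1 / (r - 1)) < \<bar>\<tau>\<bar>"
    have "1 \<le> \<bar>\<tau>\<bar>" using \<tau> powr_ge_zero[of b "1 / (r - 1)"] by linarith
    have "b = (b powr (1 / (r - 1))) powr (r - 1)"
      using r by (simp add: powr_powr b_def)
    also have "\<dots> \<le> (\<bar>\<tau>\<bar> - 1) powr (r - 1)"
      using \<tau> r by (intro powr_mono2) auto
    also have "\<dots> \<le> s_rate r (\<tau> + 1) / s_rate r \<tau>"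
      using s_rate_ratio_lower_bound[OF r \<open>1 \<le> \<bar>\<tau>\<bar>\<close>] .
    also have "\<dots> \<le> M * (\<mu> (\<tau> + 1) / \<mu> \<tau>)" by (rule le) simp
    finally have "M * c \<le> M * (\<mu> (\<tau> + 1) / \<mu> \<tau>)" by (simp add: b_def)
    then show "c \<le> \<mu> (\<tau> + 1) / \<mu> \<tau>" using M by (metis mult_le_cancel_left_pos zero_less_one less_le_trans)
  qed
qed

text \<open>An idempotent fixes every vector of its range, while a strict contraction fixes only
  0.\<close>

lemma idempotent_matrix_eq_0_if_onorm_less_1:
  fixes Q :: "real^'n^'n"
  assumes "Q ** Q = Q" "onorm ((*v) Q) < 1"
  shows "Q = 0"
proof -
  have "Q *v x = 0" for x
  proof (rule ccontr)
    assume "Q *v x \<noteq> 0"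
    then have "onorm ((*v) Q) * norm (Q *v x) < 1 * norm (Q *v x)"
      using assms(2) by (intro mult_strict_right_mono) auto
    moreover have "norm (Q *v (Q *v x)) \<le> onorm ((*v) Q) * norm (Q *v x)"
      by (rule onorm[OF matrix_vector_mul_bounded_linear])
    ultimately show False
      using assms(1) by (simp add: matrix_vector_mul_assoc)
  qed
  then show ?thesis by (simp add: matrix_eq)
qed

lemma onorm_matrix_mult_le:
  fixes A :: "real^'m^'n" and B :: "real^'k^'m"
  shows "onorm ((*v) (A ** B)) \<le> onorm ((*v) A) * onorm ((*v) B)"
  using onorm_compose[of "(*v) A" "(*v) B"]
  by (simp add: o_def matrix_vector_mul_assoc)

lemma onorm_matrix_mult_less:
  fixes A :: "real^'m^'n" and B :: "real^'k^'m"
  assumes "onorm ((*v) A) \<le> a" "onorm ((*v) B) \<le> b" "a * b < c"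
  shows "onorm ((*v) (A ** B)) < c"
proof -
  have "onorm ((*v) A) * onorm ((*v) B) \<le> a * b"
    using assms onorm_pos_le[OF matrix_vector_mul_bounded_linear, of A]
      onorm_pos_le[OF matrix_vector_mul_bounded_linear, of B]
    by (intro mult_mono) auto
  then show ?thesis using onorm_matrix_mult_le[of A B] assms(3) by linarith
qed

text \<open>Undoing the stable estimate over [\<tau>, \<tau>+1] with the backward operator costs a
  factor C and makes P(\<tau>) a contraction for large |\<tau>|; the forward operator does the same
  to Id - P(\<tau>+1). Both vanish, which contradicts the invariance of P.\<close>

lemma mu_dichotomy_unit_step_unbounded:
  fixes B :: "real \<Rightarrow> real^'n^'n" and C :: real
  assumes "fast \<mu>" and dich: "mu_dichotomy \<mu> B"
    and inverse: "\<And>t s. evolution_operator B t s ** evolution_operator B s t = mat 1"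
  obtains T where "\<And>\<tau>. \<lbrakk>onorm ((*v) (evolution_operator B (\<tau> + 1) \<tau>)) \<le> C;
      onorm ((*v) (evolution_operator B \<tau> (\<tau> + 1))) \<le> C\<rbrakk> \<Longrightarrow> \<bar>\<tau>\<bar> \<le> T"
proof -
  define \<Phi> where "\<Phi> = evolution_operator B"
  from dich obtain P K \<alpha> \<beta> where P: "\<And>s. P s ** P s = P s"
    and inv: "\<And>t s. P t ** \<Phi> t s = \<Phi> t s ** P s"
    and \<alpha>: "\<alpha> < 0" and \<beta>: "\<beta> > 0"
    and stable: "\<And>t s. s \<le> t \<Longrightarrow> onorm ((*v) (\<Phi> t s ** P s)) \<le> K * (\<mu> t / \<mu> s) powr \<alpha>"
    and unstable: "\<And>t s. t \<le> s \<Longrightarrow>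
      onorm ((*v) (\<Phi> t s ** (mat 1 - P s))) \<le> K * (\<mu> t / \<mu> s) powr \<beta>"
    unfolding mu_dichotomy_def Let_def \<Phi>_def by blast
  have "((\<lambda>\<rho>. C * (K * \<rho> powr \<alpha>)) \<longlongrightarrow> C * (K * 0)) at_top"
    using \<alpha> by (intro tendsto_intros tendsto_neg_powr filterlim_ident)
  moreover have "((\<lambda>\<rho>. C * (K * \<rho> powr (- \<beta>))) \<longlongrightarrow> C * (K * 0)) at_top"
    using \<beta> by (intro tendsto_intros tendsto_neg_powr filterlim_ident) auto
  ultimately have "\<forall>\<^sub>F \<rho> in at_top. C * (K * \<rho> powr \<alpha>) < 1 \<and> C * (K * \<rho> powr (- \<beta>)) < 1"
    by (intro eventually_conj order_tendstoD(2)) auto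
  then obtain c where c: "\<And>\<rho>. c \<le> \<rho> \<Longrightarrow> C * (K * \<rho> powr \<alpha>) < 1 \<and> C * (K * \<rho> powr (- \<beta>)) < 1"
    by (auto simp: eventually_at_top_linorder)
  obtain T where T: "\<And>\<tau>. T < \<bar>\<tau>\<bar> \<Longrightarrow> c \<le> \<mu> (\<tau> + 1) / \<mu> \<tau>"
    using fast_unit_step_ratio_unbounded[OF \<open>fast \<mu>\<close>] by blast
  show thesis
  proof (rule that[unfolded \<Phi>_def[symmetric]], rule ccontr)
    fix \<tau>
    assume C: "onorm ((*v) (\<Phi> (\<tau> + 1) \<tau>)) \<le> C" "onorm ((*v) (\<Phi> \<tau> (\<tau> + 1))) \<le> C"
      and "\<not> \<bar>\<tau>\<bar> \<le> T"
    define \<rho> where "\<rho> = \<mu> (\<tau> + 1) / \<mu> \<tau>"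
    have \<rho>: "C * (K * \<rho> powr \<alpha>) < 1" "C * (K * \<rho> powr (- \<beta>)) < 1"
      using c[of \<rho>] T[of \<tau>] \<open>\<not> \<bar>\<tau>\<bar> \<le> T\<close> by (auto simp: \<rho>_def)
    have \<Phi>_inv: "\<Phi> t s ** \<Phi> s t = mat 1" for t s
      by (simp add: \<Phi>_def inverse)
    have "onorm ((*v) (\<Phi> \<tau> (\<tau> + 1) ** (\<Phi> (\<tau> + 1) \<tau> ** P \<tau>))) < 1"
      using onorm_matrix_mult_less[OF C(2) stable[of \<tau> "\<tau> + 1"]] \<rho>(1) by (simp add: \<rho>_def)
    then have P_0: "P \<tau> = 0"
      using idempotent_matrix_eq_0_if_onorm_less_1[OF P] by (simp add: matrix_mul_assoc \<Phi>_inv)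
    \<comment> \<open>The unstable estimate runs backwards from \<tau>+1 to \<tau>, so it sees the
      reciprocal of \<rho>.\<close>
    have "(\<mu> \<tau> / \<mu> (\<tau> + 1)) powr \<beta> = \<rho> powr (- \<beta>)"
      by (simp add: \<rho>_def powr_minus_divide powr_divide inverse_eq_divide)
    then have "onorm ((*v) (\<Phi> (\<tau> + 1) \<tau> ** (\<Phi> \<tau> (\<tau> + 1) ** (mat 1 - P (\<tau> + 1))))) < 1"
      using onorm_matrix_mult_less[OF C(1) unstable[of \<tau> "\<tau> + 1"]] \<rho>(2) by simp
    moreover have "(mat 1 - P (\<tau> + 1)) ** (mat 1 - P (\<tau> + 1)) = mat 1 - P (\<tau> + 1)"
      by (simp add: P bounded_bilinear.diff_left[OF bounded_bilinear_matrix_matrix_mult]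
          bounded_bilinear.diff_right[OF bounded_bilinear_matrix_matrix_mult])
    ultimately have "mat 1 - P (\<tau> + 1) = 0"
      by (intro idempotent_matrix_eq_0_if_onorm_less_1) (simp_all add: matrix_mul_assoc \<Phi>_inv)
    \<comment> \<open>Invariance makes P(\<tau>+1) conjugate to P(\<tau>), which is 0.\<close>
    moreover have "P (\<tau> + 1) = P (\<tau> + 1) ** \<Phi> (\<tau> + 1) \<tau> ** \<Phi> \<tau> (\<tau> + 1)"
      by (simp add: \<Phi>_inv flip: matrix_mul_assoc)
    then have "P (\<tau> + 1) = 0" by (simp add: inv P_0)
    ultimately have "(mat 1 :: real^'n^'n) = 0" by simp
    \<comment> \<open>Here \<open>undefined\<close> merely names some index; the diagonal entry
      there is 1.\<close>
    then have "(mat 1 :: real^'n^'n) $ undefined $ undefined = 0" by simp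
    then show False by (simp add: mat_def)
  qed
qed

subsection \<open>Properness of the orbit map\<close>

text \<open>Near a limit point x of f(S) only parameters in some [-T, T] count. The image of that
  part of S is compact, hence closed in a Hausdorff space, so x belongs to it.\<close>

lemma closed_map_real_if_locally_bounded_parameter:
  fixes f :: "real \<Rightarrow> 'a"
  assumes X: "Hausdorff_space X" and f: "continuous_map euclideanreal X f"
    and proper: "\<And>x. x \<in> topspace X \<Longrightarrow>
      \<exists>U T. openin X U \<and> x \<in> U \<and> (\<forall>\<tau>. f \<tau> \<in> U \<longrightarrow> \<bar>\<tau>\<bar> \<le> T)"
  shows "closed_map euclideanreal X f"
  unfolding closed_map_def
proof (intro allI impI)
  fix S :: "real set" assume "closedin euclideanreal S"
  then have S: "closed S" by simp
  have "X closure_of (f ` S) \<subseteq> f ` S"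
  proof
    fix x assume x: "x \<in> X closure_of (f ` S)"
    then obtain U T where U: "openin X U" "x \<in> U" and T: "\<And>\<tau>. f \<tau> \<in> U \<Longrightarrow> \<bar>\<tau>\<bar> \<le> T"
      using proper in_closure_of by metis
    have "compact (S \<inter> {- T..T})" using S by (simp add: closed_Int_compact)
    then have "compactin X (f ` (S \<inter> {- T..T}))"
      using image_compactin[OF _ f] by simp
    then have K: "closedin X (f ` (S \<inter> {- T..T}))"
      by (rule compactin_imp_closedin[OF X])
    show "x \<in> f ` S"
    proof (rule ccontr)
      assume "x \<notin> f ` S"
      then have "x \<in> U - f ` (S \<inter> {- T..T})" using U by auto
      moreover have "openin X (U - f ` (S \<inter> {- T..T}))" using U(1) K by (rule openin_diff)
      ultimately obtain y where "y \<in> f ` S" "y \<in> U - f ` (S \<inter> {- T..T})"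
        using x unfolding in_closure_of by blast
      then show False using T by force
    qed
  qed
  moreover have "f ` S \<subseteq> topspace X"
    using f by (auto simp: continuous_map_def)
  ultimately show "closedin X (f ` S)"
    using closure_of_subset_eq by blast
qed

text \<open>Continuity on \<Omega> controls the Euclidean norm of the matrix entries, whereas the
  dichotomy is stated in the operator norm.\<close>

lemma onorm_matrix_le_norm:
  obtains c where "c > 0" "\<And>A :: real^'m^'n. onorm ((*v) A) \<le> c * norm A"
proof -
  obtain c where c: "c > 0" "\<And>A x. norm ((A :: real^'m^'n) *v x) \<le> norm A * norm x * c"
    using bounded_bilinear.pos_bounded[OF bounded_bilinear_matrix_vector_mult] by blast
  show thesis
    by (rule that[OF c(1)]) (use c in \<open>auto intro!: onorm_bound simp: mult_ac\<close>)
qed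

section \<open>Continuity, separation and return times in the base space\<close>

context base_space
begin

lemma translate_continuous_left:
  assumes "\<omega> \<in> topspace \<Omega>"
  shows "continuous_map euclideanreal \<Omega> (\<lambda>\<tau>. translate \<tau> \<omega>)"
proof -
  have "continuous_map euclideanreal (prod_topology euclideanreal \<Omega>) (\<lambda>\<tau>. (\<tau>, \<omega>))"
    using assms by (simp add: continuous_map_pairwise o_def)
  from continuous_map_compose[OF this flow_continuous] show ?thesis by (simp add: o_def)
qed

text \<open>Evaluation at t is the flow for time t followed by evaluation at 0.\<close>

lemma continuous_map_evaluation: "continuous_map \<Omega> euclidean (\<lambda>\<omega>. \<omega> t)"
proof -
  have "continuous_map \<Omega> (prod_topology euclideanreal \<Omega>) (\<lambda>\<omega>. (t, \<omega>))"
    by (simp add: continuous_map_pairwise o_def)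
  from continuous_map_compose[OF continuous_map_compose[OF this flow_continuous] eval_continuous]
  show ?thesis by (simp add: o_def translate_def eval0_def)
qed

text \<open>Reading A along the orbit recovers \<omega> itself. This upgrades local integrability to
  continuity, so the classical results on linear equations apply.\<close>

lemma continuous_on_element:
  assumes "\<omega> \<in> topspace \<Omega>"
  shows "continuous_on UNIV \<omega>"
  using continuous_map_compose[OF translate_continuous_left[OF assms] eval_continuous]
  by (simp add: o_def translate_def eval0_def)

text \<open>Distinct elements differ at some time t, and the continuous evaluation at t separates
  them.\<close>

lemma Hausdorff: "Hausdorff_space \<Omega>"
  unfolding Hausdorff_space_def
proof (intro allI impI)
  fix x y assume "x \<in> topspace \<Omega> \<and> y \<in> topspace \<Omega> \<and> x \<noteq> y"
  then have xy: "x \<in> topspace \<Omega>" "y \<in> topspace \<Omega>" "x \<noteq> y" by auto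
  then obtain t where "x t \<noteq> y t" by blast
  then obtain U V where UV: "open U" "open V" "x t \<in> U" "y t \<in> V" "U \<inter> V = {}"
    using hausdorff[of "x t" "y t"] by auto
  have "openin \<Omega> {\<omega> \<in> topspace \<Omega>. \<omega> t \<in> U}" "openin \<Omega> {\<omega> \<in> topspace \<Omega>. \<omega> t \<in> V}"
    using UV by (auto intro: openin_continuous_map_preimage[OF continuous_map_evaluation])
  moreover have "disjnt {\<omega> \<in> topspace \<Omega>. \<omega> t \<in> U} {\<omega> \<in> topspace \<Omega>. \<omega> t \<in> V}"
    using UV by (auto simp: disjnt_def)
  moreover have "x \<in> {\<omega> \<in> topspace \<Omega>. \<omega> t \<in> U}" "y \<in> {\<omega> \<in> topspace \<Omega>. \<omega> t \<in> V}"
    using xy UV by auto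
  ultimately show "\<exists>U V. openin \<Omega> U \<and> openin \<Omega> V \<and> x \<in> U \<and> y \<in> V \<and> disjnt U V"
    by blast
qed

lemma continuous_map_evolution_operator:
  "continuous_map \<Omega> euclidean (\<lambda>\<omega>. evolution_operator \<omega> t s)"
proof -
  have "continuous_map \<Omega> (prod_topology \<Omega> (prod_topology euclideanreal euclideanreal)) (\<lambda>\<omega>. (\<omega>, t, s))"
    by (simp add: continuous_map_pairwise o_def)
  from continuous_map_compose[OF this evolution_continuous] show ?thesis
    by (simp add: o_def translate_def eval0_def)
qed

text \<open>Near x the operators \<Phi>(1,0) and \<Phi>(0,1) stay bounded by continuity. At a
  translate of \<omega> they are the unit step at \<tau> and its inverse, which can both be bounded
  only for bounded \<tau>.\<close>

lemma orbit_times_locally_bounded: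
  assumes \<omega>: "\<omega> \<in> topspace \<Omega>" and "fast \<mu>" and "mu_dichotomy \<mu> \<omega>"
    and x: "x \<in> topspace \<Omega>"
  shows "\<exists>U T. openin \<Omega> U \<and> x \<in> U \<and> (\<forall>\<tau>. translate \<tau> \<omega> \<in> U \<longrightarrow> \<bar>\<tau>\<bar> \<le> T)"
proof -
  define E where "E = (\<lambda>t s \<omega> :: real \<Rightarrow> real^'n^'n. evolution_operator \<omega> t s)"
  define U where "U t s = {\<omega> \<in> topspace \<Omega>. E t s \<omega> \<in> ball 0 (norm (E t s x) + 1)}" for t s
  have U: "openin \<Omega> (U t s)" for t s
    unfolding U_def E_def
    by (rule openin_continuous_map_preimage[OF continuous_map_evolution_operator]) simp
  have xU: "x \<in> U t s" for t s using x by (simp add: U_def)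
  obtain c where c: "c > 0" "\<And>A :: real^'n^'n. onorm ((*v) A) \<le> c * norm A"
    using onorm_matrix_le_norm by blast
  \<comment> \<open>The radii of the two balls are merged into one bound, and c converts it to the
    operator norm.\<close>
  define C where "C = c * (max (norm (E 1 0 x)) (norm (E 0 1 x)) + 1)"
  note cont = continuous_on_element[OF \<omega>]
  obtain T where T: "\<And>\<tau>. \<lbrakk>onorm ((*v) (evolution_operator \<omega> (\<tau> + 1) \<tau>)) \<le> C;
      onorm ((*v) (evolution_operator \<omega> \<tau> (\<tau> + 1))) \<le> C\<rbrakk> \<Longrightarrow> \<bar>\<tau>\<bar> \<le> T"
    using mu_dichotomy_unit_step_unbounded[OF assms(2,3) evolution_operator_inverse[OF cont]] by blast
  have "\<bar>\<tau>\<bar> \<le> T" if "translate \<tau> \<omega> \<in> U 1 0 \<inter> U 0 1" for \<tau>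
  proof (rule T)
    have shift: "E t s (translate \<tau> \<omega>) = evolution_operator \<omega> (t + \<tau>) (s + \<tau>)" for t s
      using evolution_operator_translate[OF cont] by (simp add: E_def translate_def)
    have bnd: "onorm ((*v) A) \<le> C"
      if "norm A \<le> max (norm (E 1 0 x)) (norm (E 0 1 x)) + 1" for A :: "real^'n^'n"
      unfolding C_def using c(1) by (intro order_trans[OF c(2)] mult_left_mono that) simp
    have "norm (E 1 0 (translate \<tau> \<omega>)) < norm (E 1 0 x) + 1"
      "norm (E 0 1 (translate \<tau> \<omega>)) < norm (E 0 1 x) + 1"
      using that by (auto simp: U_def)
    then show "onorm ((*v) (evolution_operator \<omega> (\<tau> + 1) \<tau>)) \<le> C"
      "onorm ((*v) (evolution_operator \<omega> \<tau> (\<tau> + 1))) \<le> C"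
      using bnd[of "E 1 0 (translate \<tau> \<omega>)"] bnd[of "E 0 1 (translate \<tau> \<omega>)"]
      by (simp_all add: shift add.commute)
  qed
  then show ?thesis
    using U xU by (intro exI[of _ "U 1 0 \<inter> U 0 1"] exI[of _ T]) auto
qed

text \<open>A coincidence of two translates makes \<omega> periodic, so it returns to itself at
  arbitrarily large times, against the bound on a neighbourhood of \<omega>.\<close>

lemma inj_translate:
  assumes x: "\<omega> \<in> topspace \<Omega>"
    and bounded: "\<And>x. x \<in> topspace \<Omega> \<Longrightarrow>
      \<exists>U T. openin \<Omega> U \<and> x \<in> U \<and> (\<forall>\<tau>. translate \<tau> \<omega> \<in> U \<longrightarrow> \<bar>\<tau>\<bar> \<le> T)"
  shows "inj (\<lambda>\<tau>. translate \<tau> \<omega>)"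
proof (rule linorder_injI)
  fix a b :: real assume "a < b"
  show "translate a \<omega> \<noteq> translate b \<omega>"
  proof
    assume eq: "translate a \<omega> = translate b \<omega>"
    have per: "\<omega> (t + (b - a)) = \<omega> t" for t
      using fun_cong[OF eq, of "t - a"] by (simp add: translate_def algebra_simps)
    have "\<omega> (t + real n * (b - a)) = \<omega> t" for t n
      by (induction n) (use per in \<open>simp_all add: distrib_right flip: add.assoc add: add.commute[of "b - a"]\<close>)
    then have rec: "translate (real n * (b - a)) \<omega> = \<omega>" for n
      by (simp add: translate_def)
    obtain U T where "\<omega> \<in> U" and T: "\<And>\<tau>. translate \<tau> \<omega> \<in> U \<Longrightarrow> \<bar>\<tau>\<bar> \<le> T"
      using bounded[OF x] by blast
    obtain n where "T < real n * (b - a)"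
      using reals_Archimedean3[of "b - a"] \<open>a < b\<close> by auto
    then show False using T[of "real n * (b - a)"] rec \<open>\<omega> \<in> U\<close> by simp
  qed
qed

end

theorem corollary4p5:
  fixes \<Omega> :: "(real \<Rightarrow> real^'n^'n) topology"
    and \<omega> :: "real \<Rightarrow> real^'n^'n"
    and \<mu> :: "real \<Rightarrow> real"
  assumes "base_space \<Omega>"
    and "\<omega> \<in> topspace \<Omega>"
    and "growth_rate \<mu>" and "fast \<mu>"
  shows "(mu_dichotomy \<mu> (\<lambda>t. eval0 (translate t \<omega>)) \<longleftrightarrow> 0 \<notin> mu_spectrum \<mu> \<omega>) \<and>
         (mu_dichotomy \<mu> (\<lambda>t. eval0 (translate t \<omega>)) \<longrightarrow>
            subtopology \<Omega> (orbit \<omega>) homeomorphic_space euclideanreal \<and>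
            orbit \<omega> = orbit_hull \<Omega> \<omega>)"
proof -
  interpret base_space \<Omega> by fact
  have eval: "(\<lambda>t. eval0 (translate t \<omega>)) = \<omega>"
    by (simp add: eval0_def translate_def)
  have "mu_dichotomy \<mu> \<omega> \<longleftrightarrow> 0 \<notin> mu_spectrum \<mu> \<omega>"
    by (simp add: mu_spectrum_def)
  moreover have "subtopology \<Omega> (orbit \<omega>) homeomorphic_space euclideanreal \<and>
      orbit \<omega> = orbit_hull \<Omega> \<omega>" if "mu_dichotomy \<mu> \<omega>"
  proof
    note bounded = orbit_times_locally_bounded[OF assms(2,4) that]
    have cont: "continuous_map euclideanreal \<Omega> (\<lambda>\<tau>. translate \<tau> \<omega>)"
      using translate_continuous_left[OF assms(2)] .
    have closed: "closed_map euclideanreal \<Omega> (\<lambda>\<tau>. translate \<tau> \<omega>)"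
      using closed_map_real_if_locally_bounded_parameter[OF Hausdorff cont bounded] .
    \<comment> \<open>Injectivity and closedness make the continuous orbit map a homeomorphism onto
      its image, the orbit.\<close>
    have "embedding_map euclideanreal \<Omega> (\<lambda>\<tau>. translate \<tau> \<omega>)"
      using injective_closed_imp_embedding_map[OF cont closed] inj_translate[OF assms(2) bounded]
      by simp
    from embedding_map_imp_homeomorphic_space[OF this]
    show "subtopology \<Omega> (orbit \<omega>) homeomorphic_space euclideanreal"
      by (subst homeomorphic_space_sym) (simp add: orbit_def)
    \<comment> \<open>The orbit is the image of the closed set of all reals, hence closed and equal
      to its closure, the hull.\<close>
    have "closedin \<Omega> (orbit \<omega>)"
      using closed[unfolded closed_map_def, rule_format, of UNIV] by (simp add: orbit_def)
    then show "orbit \<omega> = orbit_hull \<Omega> \<omega>"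
      by (simp add: orbit_hull_def closure_of_closedin)
  qed
  ultimately show ?thesis unfolding eval by blast
qed

end
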